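(* Let $\mathcal{E}$ be an ellipse with semi-axes $a,b>0$ and $M$ any point of the plane. Let $A=\pi ab$ be the area of $\mathcal{E}$, and let $A_p$, $A_c$ be the signed areas of the pedal and contrapedal curves of $\mathcal{E}$ with respect to $M$. Then $A_p-A_c=A$.
   Context: Parametrize $\mathcal{E}$ by $P(t)=(a\cos t,b\sin t)$, $t\in[0,2\pi]$. The pedal curve (resp. contrapedal curve) with respect to $M$ is $t\mapsto Q_p(t)$ (resp. $t\mapsto Q_c(t)$), where $Q_p(t)$ (resp. $Q_c(t)$) is the foot of the perpendicular dropped from $M$ onto the tangent line (resp. normal line) to $\mathcal{E}$ at $P(t)$. The signed area of a closed parametrized curve $\gamma$ is $\frac12\int_\gamma(x\,dy-y\,dx)$, with orientation given by increasing $t$. *)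

theory Defs
  imports "HOL-Analysis.Analysis"
begin

type_synonym plane = "real \<times> real"

definition ellipse :: "real \<Rightarrow> real \<Rightarrow> real \<Rightarrow> plane" where
  "ellipse a b t = (a * cos t, b * sin t)"

(* The following two are meaningful where the velocity of the curve is nonzero. *)

definition tangent_line :: "(real \<Rightarrow> plane) \<Rightarrow> real \<Rightarrow> plane set" where
  "tangent_line \<gamma> t = {\<gamma> t + s *\<^sub>R vector_derivative \<gamma> (at t) | s. True}"

definition normal_line :: "(real \<Rightarrow> plane) \<Rightarrow> real \<Rightarrow> plane set" where
  "normal_line \<gamma> t = {X. orthogonal (X - \<gamma> t) (vector_derivative \<gamma> (at t))}"

definition foot :: "plane set \<Rightarrow> plane \<Rightarrow> plane" where
  "foot L M = (THE Q. Q \<in> L \<and> (\<forall>X\<in>L. orthogonal (M - Q) (X - Q)))"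

definition pedal_curve :: "(real \<Rightarrow> plane) \<Rightarrow> plane \<Rightarrow> real \<Rightarrow> plane" where
  "pedal_curve \<gamma> M t = foot (tangent_line \<gamma> t) M"

definition contrapedal_curve :: "(real \<Rightarrow> plane) \<Rightarrow> plane \<Rightarrow> real \<Rightarrow> plane" where
  "contrapedal_curve \<gamma> M t = foot (normal_line \<gamma> t) M"

(* One half of the integral of x dy - y dx over the parameter interval from u to v;
   the one-sided derivatives are used at the endpoints. *)
definition signed_area :: "real \<Rightarrow> real \<Rightarrow> (real \<Rightarrow> plane) \<Rightarrow> real" where
  "signed_area u v \<gamma> = 1 / 2 * integral {u..v} (\<lambda>t.
     let \<gamma>' = vector_derivative \<gamma> (at t within {u..v})
     in fst (\<gamma> t) * snd \<gamma>' - snd (\<gamma> t) * fst \<gamma>')"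

end

theory Submission
  imports Defs
begin

text \<open>
  Write \<open>P\<close> for the point of the curve and \<open>R\<close> for the orthogonal projection of \<open>M - P\<close> onto the
  direction of the tangent. The feet on the tangent and on the normal are \<open>P + R\<close> and \<open>M - R\<close>: they
  are opposite vertices of the rectangle with diagonal \<open>P M\<close>. With \<open>x \<times> y\<close> for the planar cross
  product, the two area integrands differ by
  \<open>(P + R) \<times> (P + R)' - (M - R) \<times> (M - R)' = P \<times> P' + R \<times> P' + (P + M) \<times> R'\<close>.
  Now \<open>R\<close> and \<open>P'\<close> are parallel, so \<open>R \<times> P' = 0\<close> and also \<open>(P + M) \<times> R' = ((P + M) \<times> R)'\<close>.
  The last derivative integrates to zero around a closed curve, which leaves \<open>P \<times> P'\<close>,
  that is, twice the signed area of the curve.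

  Only closedness, regularity and smoothness enter this argument, so
  \<open>signed_area_pedal_minus_contrapedal\<close> states it for closed regular curves of class \<open>C\<^sup>2\<close>.
  The continuous second derivative makes the integrands continuous, so that the difference of the
  two integrals is the integral of the difference. For the ellipse the signed area \<open>\<pi> a b\<close> is the integral of a constant.
\<close>

definition cross :: "plane \<Rightarrow> plane \<Rightarrow> real" where
  "cross x y = fst x * snd y - snd x * fst y"

lemma bounded_bilinear_cross: "bounded_bilinear cross"
proof
  show "\<exists>K. \<forall>x y. norm (cross x y) \<le> norm x * norm y * K"
  proof (intro exI allI)
    fix x y :: plane
    have "norm (cross x y) \<le> \<bar>fst x\<bar> * \<bar>snd y\<bar> + \<bar>snd x\<bar> * \<bar>fst y\<bar>"
      unfolding cross_def real_norm_def abs_mult[symmetric] by (rule abs_triangle_ineq4)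
    also have "\<dots> \<le> norm x * norm y + norm x * norm y"
      using norm_fst_le[of "fst x" "snd x"] norm_snd_le[of "snd x" "fst x"]
        norm_fst_le[of "fst y" "snd y"] norm_snd_le[of "snd y" "fst y"]
      by (intro add_mono mult_mono) auto
    finally show "norm (cross x y) \<le> norm x * norm y * 2" by simp
  qed
qed (simp_all add: cross_def algebra_simps)

lemma signed_area_eq_integral_cross:
  assumes "u < v"
    and "\<And>t. t \<in> {u..v} \<Longrightarrow> (\<gamma> has_vector_derivative \<gamma>' t) (at t within {u..v})"
  shows "signed_area u v \<gamma> = 1 / 2 * integral {u..v} (\<lambda>t. cross (\<gamma> t) (\<gamma>' t))"
proof -
  have "vector_derivative \<gamma> (at t within {u..v}) = \<gamma>' t" if "t \<in> {u..v}" for t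
    using assms that by (simp add: vector_derivative_within_closed_interval)
  then show ?thesis
    unfolding signed_area_def cross_def Let_def
    by (intro arg_cong[where f = "\<lambda>x. 1 / 2 * x"] integral_cong) simp
qed

text \<open>
  Two feet \<open>Q\<close> and \<open>Q'\<close> of the same point coincide because adding their orthogonality
  relations gives \<open>(Q - Q') \<bullet> (Q - Q') = 0\<close>.
\<close>
lemma foot_eqI:
  assumes "Q \<in> L" and "\<And>X. X \<in> L \<Longrightarrow> orthogonal (M - Q) (X - Q)"
  shows "foot L M = Q"
  unfolding foot_def
proof (rule the_equality)
  fix Q' assume Q': "Q' \<in> L \<and> (\<forall>X\<in>L. orthogonal (M - Q') (X - Q'))"
  have "(M - Q) \<bullet> (Q' - Q) + (M - Q') \<bullet> (Q - Q') = 0"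
    using assms Q' by (simp add: orthogonal_def)
  then have "(Q - Q') \<bullet> (Q - Q') = 0"
    by (simp add: inner_diff_left inner_diff_right inner_commute)
  then show "Q' = Q" by simp
qed (use assms in blast)

definition proj_along :: "plane \<Rightarrow> plane \<Rightarrow> plane" where
  "proj_along T w = (w \<bullet> T / (T \<bullet> T)) *\<^sub>R T"

lemma cross_proj_along_self: "cross (proj_along T w) T = 0" "cross T (proj_along T w) = 0"
  by (simp_all add: proj_along_def cross_def)

lemma proj_along_residual_orthogonal: "(w - proj_along T w) \<bullet> T = 0"
  by (simp add: proj_along_def inner_diff_left)

lemma pedal_curve_eq:
  assumes "(\<gamma> has_vector_derivative T) (at t)"
  shows "pedal_curve \<gamma> M t = \<gamma> t + proj_along T (M - \<gamma> t)"
  unfolding pedal_curve_def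
proof (rule foot_eqI)
  let ?c = "(M - \<gamma> t) \<bullet> T / (T \<bullet> T)"
  have L: "tangent_line \<gamma> t = {\<gamma> t + s *\<^sub>R T | s. True}"
    using assms by (simp add: tangent_line_def vector_derivative_at)
  show "\<gamma> t + proj_along T (M - \<gamma> t) \<in> tangent_line \<gamma> t"
    unfolding L proj_along_def by blast
  fix X assume "X \<in> tangent_line \<gamma> t"
  then obtain s where s: "X = \<gamma> t + s *\<^sub>R T" unfolding L by blast
  have X: "X - (\<gamma> t + proj_along T (M - \<gamma> t)) = (s - ?c) *\<^sub>R T"
    unfolding s proj_along_def by (simp add: scaleR_diff_left)
  have "(M - (\<gamma> t + proj_along T (M - \<gamma> t))) \<bullet> T = 0"
    using proj_along_residual_orthogonal[of "M - \<gamma> t" T] by (simp add: diff_diff_eq)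
  then show "orthogonal (M - (\<gamma> t + proj_along T (M - \<gamma> t)))
      (X - (\<gamma> t + proj_along T (M - \<gamma> t)))"
    unfolding X orthogonal_def by simp
qed

lemma contrapedal_curve_eq:
  assumes "(\<gamma> has_vector_derivative T) (at t)"
  shows "contrapedal_curve \<gamma> M t = M - proj_along T (M - \<gamma> t)"
  unfolding contrapedal_curve_def
proof (rule foot_eqI)
  let ?R = "proj_along T (M - \<gamma> t)"
  have L: "X \<in> normal_line \<gamma> t \<longleftrightarrow> (X - \<gamma> t) \<bullet> T = 0" for X
    using assms by (simp add: normal_line_def orthogonal_def vector_derivative_at)
  have foot: "(M - ?R - \<gamma> t) \<bullet> T = 0"
    using proj_along_residual_orthogonal[of "M - \<gamma> t" T] by (simp add: algebra_simps)
  then show "M - ?R \<in> normal_line \<gamma> t" by (simp add: L)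
  fix X assume "X \<in> normal_line \<gamma> t"
  then have "(X - (M - ?R)) \<bullet> T = 0"
    using foot by (simp add: L inner_diff_left)
  then have "T \<bullet> (X - (M - ?R)) = 0" by (simp add: inner_commute)
  then show "orthogonal (M - (M - ?R)) (X - (M - ?R))"
    by (simp add: orthogonal_def proj_along_def)
qed

text \<open>
  The curve must have a two-sided derivative at the endpoints because the tangent and normal lines
  are defined by it. Equal end velocities ensure that the projection of \<open>M - \<gamma> t\<close> onto the tangent
  direction returns to its initial value.
\<close>
theorem signed_area_pedal_minus_contrapedal:
  fixes \<gamma> T A :: "real \<Rightarrow> plane" and M :: plane
  assumes uv: "u < v"
    and T: "\<And>t. t \<in> {u..v} \<Longrightarrow> (\<gamma> has_vector_derivative T t) (at t)"
    and A: "\<And>t. t \<in> {u..v} \<Longrightarrow> (T has_vector_derivative A t) (at t within {u..v})"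
    and contA: "continuous_on {u..v} A"
    and regular: "\<And>t. t \<in> {u..v} \<Longrightarrow> T t \<noteq> 0"
    and closed: "\<gamma> u = \<gamma> v" "T u = T v"
  shows "signed_area u v (pedal_curve \<gamma> M) - signed_area u v (contrapedal_curve \<gamma> M)
    = signed_area u v \<gamma>"
proof -
  interpret cross: bounded_bilinear cross by (rule bounded_bilinear_cross)
  let ?I = "{u..v}"
  define R where "R = (\<lambda>t. proj_along (T t) (M - \<gamma> t))"
  define c where "c = (\<lambda>t. (M - \<gamma> t) \<bullet> T t / (T t \<bullet> T t))"
  define c' where "c' = (\<lambda>t. (((M - \<gamma> t) \<bullet> A t + (- T t) \<bullet> T t) * (T t \<bullet> T t)
    - (M - \<gamma> t) \<bullet> T t * (T t \<bullet> A t + A t \<bullet> T t)) / (T t \<bullet> T t * (T t \<bullet> T t)))"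
  define R' where "R' = (\<lambda>t. c t *\<^sub>R A t + c' t *\<^sub>R T t)"
  have T_within: "(\<gamma> has_vector_derivative T t) (at t within ?I)" if "t \<in> ?I" for t
    using T[OF that] by (rule has_vector_derivative_at_within)
  have R': "(R has_vector_derivative R' t) (at t within ?I)" if t: "t \<in> ?I" for t
  proof -
    have num: "((\<lambda>t. (M - \<gamma> t) \<bullet> T t) has_vector_derivative
        (M - \<gamma> t) \<bullet> A t + (- T t) \<bullet> T t) (at t within ?I)"
      using has_vector_derivative_diff[OF has_vector_derivative_const T_within[OF t]] A[OF t]
      by (intro bounded_bilinear.has_vector_derivative[OF bounded_bilinear_inner]) auto
    have den: "((\<lambda>t. T t \<bullet> T t) has_vector_derivative T t \<bullet> A t + A t \<bullet> T t) (at t within ?I)"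
      by (intro bounded_bilinear.has_vector_derivative[OF bounded_bilinear_inner] A t)
    have "(c has_real_derivative c' t) (at t within ?I)"
      unfolding c_def c'_def
      using num den regular[OF t]
      by (intro DERIV_divide) (simp_all add: has_real_derivative_iff_has_vector_derivative)
    then show ?thesis
      unfolding R_def proj_along_def c_def[symmetric] R'_def
      using has_vector_derivative_scaleR[OF _ A[OF t], of c "c' t"] by (simp add: c_def)
  qed
  have cont\<gamma>: "continuous_on ?I \<gamma>" and contT: "continuous_on ?I T" and contR: "continuous_on ?I R"
    using T_within A R' has_vector_derivative_continuous continuous_on_eq_continuous_within by blast+
  have contR': "continuous_on ?I R'"
    unfolding R'_def c_def c'_def using regular
    by (intro continuous_intros cont\<gamma> contT contA) auto
  have pedal: "signed_area u v (pedal_curve \<gamma> M)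
      = 1 / 2 * integral ?I (\<lambda>t. cross (\<gamma> t + R t) (T t + R' t))"
  proof -
    have eq: "pedal_curve \<gamma> M t = \<gamma> t + R t" if "t \<in> ?I" for t
      using pedal_curve_eq[OF T[OF that]] by (simp add: R_def)
    have "(pedal_curve \<gamma> M has_vector_derivative T t + R' t) (at t within ?I)" if "t \<in> ?I" for t
      by (rule has_vector_derivative_transform[OF that _
            has_vector_derivative_add[OF T_within[OF that] R'[OF that]]]) (rule eq)
    note area = signed_area_eq_integral_cross[OF uv this]
    have "integral ?I (\<lambda>t. cross (pedal_curve \<gamma> M t) (T t + R' t))
        = integral ?I (\<lambda>t. cross (\<gamma> t + R t) (T t + R' t))"
      by (rule integral_cong) (simp add: eq)
    with area show ?thesis by simp
  qed
  have contrapedal: "signed_area u v (contrapedal_curve \<gamma> M)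
      = 1 / 2 * integral ?I (\<lambda>t. cross (M - R t) (0 - R' t))"
  proof -
    have eq: "contrapedal_curve \<gamma> M t = M - R t" if "t \<in> ?I" for t
      using contrapedal_curve_eq[OF T[OF that]] by (simp add: R_def)
    have "(contrapedal_curve \<gamma> M has_vector_derivative 0 - R' t) (at t within ?I)"
      if "t \<in> ?I" for t
      by (rule has_vector_derivative_transform[OF that _
            has_vector_derivative_diff[OF has_vector_derivative_const R'[OF that]]]) (rule eq)
    note area = signed_area_eq_integral_cross[OF uv this]
    have "integral ?I (\<lambda>t. cross (contrapedal_curve \<gamma> M t) (0 - R' t))
        = integral ?I (\<lambda>t. cross (M - R t) (0 - R' t))"
      by (rule integral_cong) (simp add: eq)
    with area show ?thesis by simp
  qed
  have curve: "signed_area u v \<gamma> = 1 / 2 * integral ?I (\<lambda>t. cross (\<gamma> t) (T t))"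
    using uv T_within by (rule signed_area_eq_integral_cross)
  \<comment> \<open>The integrand is the derivative of \<open>cross (\<gamma> t + M) (R t)\<close>; its second summand is zero
    pointwise and is kept to match the product rule.\<close>
  have exact: "((\<lambda>t. cross (\<gamma> t + M) (R' t) + cross (T t) (R t)) has_integral 0) ?I"
  proof -
    have "((\<lambda>t. cross (\<gamma> t + M) (R t)) has_vector_derivative
        cross (\<gamma> t + M) (R' t) + cross (T t) (R t)) (at t within ?I)" if t: "t \<in> ?I" for t
      using has_vector_derivative_add[OF T_within[OF t] has_vector_derivative_const] R'[OF t]
      by (intro cross.has_vector_derivative) auto
    from fundamental_theorem_of_calculus[OF less_imp_le[OF uv] this] show ?thesis
      using closed by (simp add: R_def)
  qed
  have parallel: "cross (T t) (R t) = 0" "cross (R t) (T t) = 0" for t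
    by (simp_all add: R_def cross_proj_along_self)
  have "integral ?I (\<lambda>t. cross (\<gamma> t + R t) (T t + R' t))
      - integral ?I (\<lambda>t. cross (M - R t) (0 - R' t))
      = integral ?I (\<lambda>t. cross (\<gamma> t + R t) (T t + R' t) - cross (M - R t) (0 - R' t))"
    by (intro integral_diff[symmetric] integrable_continuous_interval cross.continuous_on
        continuous_intros cont\<gamma> contT contR contR')
  also have "\<dots> = integral ?I (\<lambda>t. cross (\<gamma> t) (T t)
      + (cross (\<gamma> t + M) (R' t) + cross (T t) (R t)))"
    by (intro integral_cong)
      (simp add: parallel cross.add_left cross.add_right cross.diff_left cross.minus_right)
  also have "\<dots> = integral ?I (\<lambda>t. cross (\<gamma> t) (T t))
      + integral ?I (\<lambda>t. cross (\<gamma> t + M) (R' t) + cross (T t) (R t))"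
    by (intro integral_add integrable_continuous_interval cross.continuous_on
        continuous_intros cont\<gamma> contT contR contR')
  also have "\<dots> = integral ?I (\<lambda>t. cross (\<gamma> t) (T t))"
    using integral_unique[OF exact] by simp
  finally show ?thesis
    unfolding pedal contrapedal curve
    by (simp add: algebra_simps)
qed

lemma ellipse_has_vector_derivative:
  "(ellipse a b has_vector_derivative (- a * sin t, b * cos t)) (at t within S)"
proof -
  have "((\<lambda>t. a * cos t) has_vector_derivative - a * sin t) (at t within S)"
    "((\<lambda>t. b * sin t) has_vector_derivative b * cos t) (at t within S)"
    unfolding has_real_derivative_iff_has_vector_derivative[symmetric]
    by (auto intro!: derivative_eq_intros)
  from has_vector_derivative_Pair[OF this] show ?thesis
    by (simp add: ellipse_def[abs_def])
qed

lemma ellipse_velocity_has_vector_derivative: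
  "((\<lambda>t. (- a * sin t, b * cos t)) has_vector_derivative (- a * cos t, - b * sin t))
    (at t within S)"
proof -
  have "((\<lambda>t. - a * sin t) has_vector_derivative - a * cos t) (at t within S)"
    "((\<lambda>t. b * cos t) has_vector_derivative - b * sin t) (at t within S)"
    unfolding has_real_derivative_iff_has_vector_derivative[symmetric]
    by (auto intro!: derivative_eq_intros)
  from has_vector_derivative_Pair[OF this] show ?thesis .
qed

lemma ellipse_velocity_nonzero:
  assumes "a \<noteq> 0" and "b \<noteq> 0"
  shows "(- a * sin t, b * cos t) \<noteq> (0 :: plane)"
  using assms sin_zero_norm_cos_one[of t] by (auto simp: zero_prod_def)

lemma signed_area_ellipse: "signed_area 0 (2 * pi) (ellipse a b) = pi * a * b"
proof -
  have "cross (ellipse a b t) (- a * sin t, b * cos t) = a * b" for t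
  proof -
    have "cross (ellipse a b t) (- a * sin t, b * cos t) = a * b * (cos t * cos t + sin t * sin t)"
      unfolding cross_def ellipse_def by (simp add: algebra_simps del: sin_cos_squared_add3)
    then show ?thesis by simp
  qed
  then show ?thesis
    using signed_area_eq_integral_cross[OF _ ellipse_has_vector_derivative[of a b], of 0 "2 * pi"]
    by simp
qed

theorem corollary4:
  fixes a b :: real and M :: plane
  assumes "a > 0" and "b > 0"
  shows "signed_area 0 (2 * pi) (pedal_curve (ellipse a b) M)
       - signed_area 0 (2 * pi) (contrapedal_curve (ellipse a b) M) = pi * a * b"
proof -
  have "continuous_on {0..2 * pi} (\<lambda>t. (- a * cos t, - b * sin t))"
    by (intro continuous_intros)
  then have "signed_area 0 (2 * pi) (pedal_curve (ellipse a b) M)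
      - signed_area 0 (2 * pi) (contrapedal_curve (ellipse a b) M)
      = signed_area 0 (2 * pi) (ellipse a b)"
    using assms
    by (intro signed_area_pedal_minus_contrapedal[OF _ ellipse_has_vector_derivative
          ellipse_velocity_has_vector_derivative _ ellipse_velocity_nonzero])
      (simp_all add: ellipse_def)
  then show ?thesis by (simp add: signed_area_ellipse)
qed

end
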